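(* Let $n\ge2$, let $\kappa>0$ be a real number, and let $W\subseteq C(S^{n-1})$ be a finite-dimensional linear subspace containing the constant functions. If $\beta=\min\left(\dim(W)^{-\frac{1}{n-1}},\frac{2}{\kappa}\right)$, then \[ \sup_{f\in\Lambda(\kappa)} d(f,W)\ \ge\ \kappa\,\frac{\beta}{2}. \] In particular, for each choice $f\in\{\gamma,\rho\}$ (gauge or radial function), there exists a positive constant $C_0$ such that, for all sufficiently large $d$, there is some starbody $L\subset\mathbb{R}^n$ with $f_L\in\Lambda(\kappa)$ for which the inequality \[ \|f_L-p\|_\infty\ \ge\ C_0\,\frac{\kappa}{d} \] holds for every polynomial $p$ of degree at most $d$ restricted to $S^{n-1}$.
   Context: $S^{n-1}\subset\mathbb{R}^n$ is the unit sphere, $C(S^{n-1})$ is the space of continuous real-valued functions on it with the supremum norm $\|\cdot\|_\infty$, and $d(f,W)=\inf_{w\in W}\|f-w\|_\infty$. $\Lambda(\kappa)\subseteq C(S^{n-1})$ is the set of nonnegative functions for which $\kappa$ is a valid Lipschitz constant with respect to the geodesic distance $\arccos\langle x,y\rangle$ on $S^{n-1}$. A starbody is a compact set $L\subseteq\mathbb{R}^n$ that is starshaped with respect to the origin (for each $x\in L$ the segment $[0,x]$ lies in $L$) and contains the origin in its interior. Its gauge and radial functions on $S^{n-1}$ are $\gamma_L(x)=\inf\{\lambda>0:x\in\lambda L\}$ and $\rho_L(x)=\sup\{\lambda>0:\lambda x\in L\}$. *)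

theory Defs
  imports "HOL-Analysis.Analysis"
begin

subsection \<open>The unit sphere as a metric space\<close>

typedef ('n::finite) usphere = "sphere (0 :: real ^ 'n) 1"
  morphisms point Usphere
  by (rule exI[of _ "axis undefined 1"]) simp

text \<open>
  The library distance \<^const>\<open>dist\<close> on the sphere is the chordal one; it only serves to
  provide the subspace topology.  The geodesic distance is kept as a separate function.
\<close>

instantiation usphere :: (finite) metric_space
begin

definition dist_usphere :: "'a usphere \<Rightarrow> 'a usphere \<Rightarrow> real"
  where "dist_usphere x y = dist (point x) (point y)"

definition uniformity_usphere :: "('a usphere \<times> 'a usphere) filter"
  where "uniformity_usphere = (INF e\<in>{0 <..}. principal {(x, y). dist x y < e})"

definition open_usphere :: "'a usphere set \<Rightarrow> bool"
  where "open_usphere S = (\<forall>x\<in>S. \<forall>\<^sub>F (x', y) in uniformity. x' = x \<longrightarrow> y \<in> S)"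

instance
proof
  fix x y z :: "'a usphere"
  show "dist x y = 0 \<longleftrightarrow> x = y"
    by (simp add: dist_usphere_def point_inject)
  show "dist x y \<le> dist x z + dist y z"
    by (simp add: dist_usphere_def dist_triangle2)
qed (rule open_usphere_def uniformity_usphere_def)+

end

lemma norm_point [simp]: "norm (point x) = 1"
  using point[of x] by simp

lemma range_point: "range point = sphere 0 1"
  using type_definition.Rep_range[OF type_definition_usphere] .

lemma continuous_on_point [continuous_intros]: "continuous_on A point"
  unfolding continuous_on_iff by (auto simp: dist_usphere_def)

lemma continuous_on_Usphere: "continuous_on (sphere 0 1) Usphere"
  unfolding continuous_on_iff by (auto simp: dist_usphere_def Usphere_inverse)

lemma compact_UNIV_usphere: "compact (UNIV :: 'n::finite usphere set)"
proof -
  have "UNIV = Usphere ` sphere (0 :: real ^ 'n) 1"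
    using type_definition.Abs_image[OF type_definition_usphere] by (rule sym)
  then show ?thesis
    using compact_continuous_image[OF continuous_on_Usphere compact_sphere] by metis
qed

definition geodist :: "'n::finite usphere \<Rightarrow> 'n usphere \<Rightarrow> real"
  where "geodist x y = arccos (point x \<bullet> point y)"

text \<open>
  The space of continuous functions on the sphere, with the supremum norm, is the normed
  space of bounded continuous functions; by compactness boundedness is automatic.
\<close>

type_synonym 'n csphere = "'n usphere \<Rightarrow>\<^sub>C real"

lemma bcontfun_usphere_iff:
  fixes f :: "'n::finite usphere \<Rightarrow> real"
  shows "f \<in> bcontfun \<longleftrightarrow> continuous_on UNIV f"
  unfolding bcontfun_def
  using compact_continuous_image[OF _ compact_UNIV_usphere] compact_imp_bounded by blast

subsection \<open>Nonnegative Lipschitz functions\<close>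

definition Lip :: "real \<Rightarrow> 'n::finite csphere set"
  where "Lip \<kappa> = {f :: 'n csphere. (\<forall>x. 0 \<le> f x) \<and> (\<forall>x y. \<bar>f x - f y\<bar> \<le> \<kappa> * geodist x y)}"

text \<open>The real-valued supremum of the distances to a space containing the constants is proper.\<close>

lemma bdd_above_infdist_Lip:
  fixes W :: "'n::finite csphere set"
  assumes "0 \<le> \<kappa>" and const: "\<And>c. const_bcontfun c \<in> W"
  shows "bdd_above ((\<lambda>f. infdist f W) ` Lip \<kappa>)"
proof (rule bdd_aboveI2)
  fix f :: "'n csphere" assume f: "f \<in> Lip \<kappa>"
  obtain x0 :: "'n usphere" where True by simp
  have "dist (f x) (const_bcontfun (f x0) x) \<le> \<kappa> * pi" for x
  proof -
    have "\<bar>point x \<bullet> point x0\<bar> \<le> 1"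
      using Cauchy_Schwarz_ineq2[of "point x" "point x0"] by simp
    then have "geodist x x0 \<le> pi"
      unfolding geodist_def by (intro arccos_ubound) auto
    moreover have "\<bar>f x - f x0\<bar> \<le> \<kappa> * geodist x x0"
      using f by (auto simp: Lip_def)
    ultimately show ?thesis
      using \<open>0 \<le> \<kappa>\<close> mult_left_mono[of "geodist x x0" pi \<kappa>]
      by (simp add: dist_real_def const_bcontfun.rep_eq)
  qed
  then have "dist f (const_bcontfun (f x0)) \<le> \<kappa> * pi"
    by (rule dist_bound)
  then show "infdist f W \<le> \<kappa> * pi"
    using infdist_le2[OF const] by blast
qed

subsection \<open>Polynomials\<close>

definition poly_deg_le :: "nat \<Rightarrow> (real ^ 'n::finite \<Rightarrow> real) \<Rightarrow> bool"
  where "poly_deg_le d P \<longleftrightarrow>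
    (\<exists>c. \<forall>x. P x = (\<Sum>\<alpha> | (\<Sum>i\<in>UNIV. \<alpha> i) \<le> d. c \<alpha> * (\<Prod>i\<in>UNIV. (x $ i) ^ \<alpha> i)))"

lemma finite_exponents: "finite {\<alpha> :: 'n::finite \<Rightarrow> nat. (\<Sum>i\<in>UNIV. \<alpha> i) \<le> d}"
proof (rule finite_subset)
  show "{\<alpha> :: 'n \<Rightarrow> nat. (\<Sum>i\<in>UNIV. \<alpha> i) \<le> d} \<subseteq> Pi\<^sub>E UNIV (\<lambda>_. {..d})"
  proof (intro subsetI PiE_I)
    fix \<alpha> :: "'n \<Rightarrow> nat" and i
    assume "\<alpha> \<in> {\<alpha>. (\<Sum>i\<in>UNIV. \<alpha> i) \<le> d}"
    moreover have "\<alpha> i \<le> (\<Sum>i\<in>UNIV. \<alpha> i)"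
      by (rule member_le_sum) auto
    ultimately show "\<alpha> i \<in> {..d}"
      by simp
  qed auto
qed (simp add: finite_PiE)

definition sphere_polys :: "nat \<Rightarrow> 'n::finite csphere set"
  where "sphere_polys d = {p :: 'n csphere. \<exists>P. poly_deg_le d P \<and> (\<forall>x. p x = P (point x))}"

lemma sphere_polys_restrict:
  assumes "poly_deg_le d P"
  obtains p where "p \<in> sphere_polys d" and "\<And>x. apply_bcontfun p x = P (point x)"
proof -
  obtain c where c: "\<And>x. P x = (\<Sum>\<alpha> | (\<Sum>i\<in>UNIV. \<alpha> i) \<le> d. c \<alpha> * (\<Prod>i\<in>UNIV. (x $ i) ^ \<alpha> i))"
    using assms unfolding poly_deg_le_def by blast
  have "(\<lambda>x. P (point x)) \<in> bcontfun"
    unfolding bcontfun_usphere_iff c by (intro continuous_intros)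
  then obtain p where "(\<lambda>x. P (point x)) = apply_bcontfun p"
    by (metis Bcontfun_inverse)
  then have "\<And>x. apply_bcontfun p x = P (point x)"
    by (simp add: fun_eq_iff)
  with assms that show ?thesis
    unfolding sphere_polys_def by blast
qed

subsection \<open>Starbodies\<close>

definition starbody :: "(real ^ 'n::finite) set \<Rightarrow> bool"
  where "starbody L \<longleftrightarrow> compact L \<and> (\<forall>x\<in>L. closed_segment 0 x \<subseteq> L) \<and> 0 \<in> interior L"

definition gauge_fun :: "(real ^ 'n::finite) set \<Rightarrow> 'n usphere \<Rightarrow> real"
  where "gauge_fun L x = Inf {t. 0 < t \<and> point x \<in> (\<lambda>y. t *\<^sub>R y) ` L}"

definition radial_fun :: "(real ^ 'n::finite) set \<Rightarrow> 'n usphere \<Rightarrow> real"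
  where "radial_fun L x = Sup {t. 0 < t \<and> t *\<^sub>R point x \<in> L}"

end

theory Submission
  imports Defs
begin

text \<open>
  A space of dimension \<open>D\<close> is annihilated by a nonzero measure supported on any given \<open>D + 1\<close> points.
  If these points are \<open>\<epsilon>\<close>-separated and the measure kills the constants, then a \<open>\<kappa>\<close>-Lipschitz
  function that differs by \<open>\<kappa> * \<epsilon>\<close> between the positive and the negative atoms has distance at
  least \<open>\<kappa> * \<epsilon> / 2\<close> from the space. Chordal distances suffice, since they are at most the
  geodesic ones. A volume comparison provides \<open>D + 1\<close> points with \<open>\<epsilon> = D powr (- 1 / (n - 1))\<close>.
  For polynomials of degree at most \<open>d\<close> it is enough to look at one great circle, on which they
  span a space of dimension \<open>O(d)\<close> whatever \<open>n\<close> is.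
\<close>

subsection \<open>Lower bounds by duality\<close>

text \<open>A chord subtending the angle \<open>t\<close> has length 2 sin(t/2), and sin(t/2) is at
  most t/2. Hence separation and Lipschitz estimates may be made in the chordal metric.\<close>

lemma dist_le_geodist: "dist x y \<le> geodist x y"
proof -
  let ?t = "geodist x y"
  have "\<bar>point x \<bullet> point y\<bar> \<le> 1"
    using Cauchy_Schwarz_ineq2[of "point x" "point y"] by simp
  then have inner: "point x \<bullet> point y = cos ?t" and t: "0 \<le> ?t"
    unfolding geodist_def by (auto intro: arccos_lbound simp: cos_arccos_abs)
  have "(dist x y)\<^sup>2 = 2 - 2 * (point x \<bullet> point y)"
    by (simp add: dist_usphere_def dist_norm power2_norm_eq_inner inner_diff inner_commute
        norm_eq_1[THEN iffD1, OF norm_point])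
  also have "\<dots> = (2 * sin (?t / 2))\<^sup>2"
    unfolding inner using cos_double_sin[of "?t / 2"] by (simp add: power_mult_distrib)
  also have "\<dots> \<le> ?t\<^sup>2"
    using abs_sin_x_le_abs_x[of "?t / 2"] by (intro abs_le_square_iff[THEN iffD1]) simp
  finally show ?thesis
    using t power2_le_imp_le by blast
qed

text \<open>A homogeneous linear system with fewer equations than unknowns has a nontrivial
  solution. The induction is Gaussian elimination, one equation \<open>b\<close> and one pivot point
  \<open>q\<close> at a time.\<close>

lemma exists_annihilator:
  fixes g :: "'b \<Rightarrow> 'p \<Rightarrow> 'a::field"
  assumes "finite B" "finite P" "card B < card P"
  shows "\<exists>a. (\<exists>p\<in>P. a p \<noteq> 0) \<and> (\<forall>b\<in>B. (\<Sum>p\<in>P. a p * g b p) = 0)"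
  using assms
proof (induction B arbitrary: P g rule: finite_induct)
  case empty
  then have "P \<noteq> {}" by auto
  then show ?case by (auto intro!: exI[of _ "\<lambda>_. 1"])
next
  case (insert b B)
  show ?case
  proof (cases "\<forall>p\<in>P. g b p = 0")
    case True
    then show ?thesis
      using insert.IH[of P g] insert.prems insert.hyps by auto
  next
    case False
    then obtain q where q: "q \<in> P" "g b q \<noteq> 0" by blast
    \<comment> \<open>Subtracting a multiple of row \<open>b\<close> makes every row vanish at the
      pivot \<open>q\<close>, so the reduced system lives on \<open>P - {q}\<close>.\<close>
    define h where "h c p = g c p - g c q / g b q * g b p" for c p
    have "card B < card (P - {q})"
      using insert q by simp
    then obtain a where a: "\<exists>p\<in>P - {q}. a p \<noteq> 0"
      "\<And>c. c \<in> B \<Longrightarrow> (\<Sum>p\<in>P - {q}. a p * h c p) = 0"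
      using insert.IH[of "P - {q}" h] insert.prems by auto
    define s where "s = (\<Sum>p\<in>P - {q}. a p * g b p)"
    \<comment> \<open>The weight at \<open>q\<close> is solved from equation \<open>b\<close>; the
      other equations then hold by back substitution.\<close>
    define a' where "a' p = (if p = q then - s / g b q else a p)" for p
    have sum: "(\<Sum>p\<in>P. a' p * g c p) = - s / g b q * g c q + (\<Sum>p\<in>P - {q}. a p * g c p)" for c
      using q(1) insert.prems(1) by (simp add: sum.remove a'_def)
    have "(\<Sum>p\<in>P. a' p * g c p) = 0" if "c \<in> insert b B" for c
    proof (cases "c = b")
      case True
      then show ?thesis using q(2) by (simp add: sum flip: s_def)
    next
      case False
      with that have "c \<in> B" by simp
      from a(2)[OF this] have "(\<Sum>p\<in>P - {q}. a p * g c p) - g c q / g b q * s = 0"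
        by (simp add: h_def s_def algebra_simps sum_subtractf sum_distrib_left)
      then show ?thesis by (simp add: sum field_simps)
    qed
    moreover have "\<exists>p\<in>P. a' p \<noteq> 0"
      using a(1) by (auto simp: a'_def)
    ultimately show ?thesis by blast
  qed
qed

text \<open>
  The lower bound on the distance comes from pairing with the measure
  \<open>\<Sum>p\<in>P. a p \<cdot> \<delta>\<^sub>p\<close>; the extremal function takes two values on \<open>P\<close>, according to the sign of
  \<open>a\<close>, and its additive constant is invisible to the measure by the assumption \<open>(\<Sum>p\<in>P. a p) = 0\<close>.
\<close>

lemma Lip_far_from_annihilated:
  fixes P :: "'n::finite usphere set" and a :: "'n usphere \<Rightarrow> real"
  assumes "finite P" "0 \<le> \<beta>" "0 \<le> \<kappa>" "0 \<le> s"
    and sep: "\<And>p q. \<lbrakk>p \<in> P; q \<in> P; p \<noteq> q\<rbrakk> \<Longrightarrow> \<beta> \<le> dist p q"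
    and nz: "\<exists>p\<in>P. a p \<noteq> 0" and sum0: "(\<Sum>p\<in>P. a p) = 0"
  obtains f :: "'n csphere" where "f \<in> Lip \<kappa>" "\<And>x. s \<le> f x"
    "\<And>w :: 'n csphere. (\<Sum>p\<in>P. a p * apply_bcontfun w p) = 0 \<Longrightarrow> \<kappa> * (\<beta> / 2) \<le> norm (f - w)"
proof -
  define N where "N = {p\<in>P. a p < 0}"
  have "N \<noteq> {}"
  proof
    assume "N = {}"
    then have "\<forall>p\<in>P. 0 \<le> a p" by (auto simp: N_def not_less)
    with sum0 have "\<forall>p\<in>P. a p = 0"
      using \<open>finite P\<close> by (simp add: sum_nonneg_eq_0_iff)
    with nz show False by blast
  qed
  \<comment> \<open>On \<open>P\<close> this takes only two values: \<open>s\<close> at the negative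
    atoms, and \<open>s + \<kappa> * \<beta>\<close> at the others, which separation keeps at
    distance at least \<open>\<beta>\<close> from \<open>N\<close>. The floor \<open>s\<close>
    allows the function to be made strictly positive.\<close>
  define h where "h x = s + \<kappa> * min \<beta> (infdist x N)" for x :: "'n usphere"
  have "continuous_on UNIV h"
    unfolding h_def by (intro continuous_intros continuous_on_infdist)
  then have h: "h \<in> bcontfun" by (simp add: bcontfun_usphere_iff)
  define f where "f = Bcontfun h"
  have f: "apply_bcontfun f = h" unfolding f_def by (rule Bcontfun_inverse[OF h])
  have ge: "s \<le> f x" for x
    using assms(2,3) by (simp add: f h_def infdist_nonneg)
  have "\<bar>f x - f y\<bar> \<le> \<kappa> * geodist x y" for x y
  proof -
    have "\<bar>min \<beta> (infdist x N) - min \<beta> (infdist y N)\<bar> \<le> \<bar>infdist x N - infdist y N\<bar>"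
      by (auto simp: min_def abs_if)
    also have "\<dots> \<le> geodist x y"
      using infdist_triangle_abs dist_le_geodist order_trans by blast
    finally show ?thesis
      using \<open>0 \<le> \<kappa>\<close>
      by (simp add: f h_def abs_mult mult_left_mono flip: right_diff_distrib)
  qed
  moreover have "0 \<le> f x" for x using ge[of x] \<open>0 \<le> s\<close> by linarith
  ultimately have Lip: "f \<in> Lip \<kappa>" by (auto simp: Lip_def)
  \<comment> \<open>Relative to the midpoint of the two values, \<open>f\<close> is plus or minus
    \<open>\<kappa> * \<beta> / 2\<close> with the sign of \<open>a p\<close>, so the pairing with
    the measure yields its total variation.\<close>
  have fP: "a p * (f p - (s + \<kappa> * (\<beta> / 2))) = \<kappa> * (\<beta> / 2) * \<bar>a p\<bar>" if "p \<in> P" for p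
  proof (cases "a p < 0")
    case True
    with that have "infdist p N = 0" by (simp add: N_def)
    then show ?thesis using True \<open>0 \<le> \<beta>\<close> by (simp add: f h_def)
  next
    case False
    have "\<beta> \<le> dist p q" if "q \<in> N" for q
      using sep[of p q] that \<open>p \<in> P\<close> False by (auto simp: N_def)
    then have "\<beta> \<le> infdist p N"
      using \<open>N \<noteq> {}\<close> by (simp add: infdist_def cINF_greatest)
    then show ?thesis using False by (simp add: f h_def)
  qed
  have pos: "0 < (\<Sum>p\<in>P. \<bar>a p\<bar>)"
    using nz \<open>finite P\<close> by (auto intro: sum_pos2)
  have "\<kappa> * (\<beta> / 2) \<le> norm (f - w)" if w: "(\<Sum>p\<in>P. a p * apply_bcontfun w p) = 0" for w :: "'n csphere"
  proof -
    have "\<kappa> * (\<beta> / 2) * (\<Sum>p\<in>P. \<bar>a p\<bar>) = (\<Sum>p\<in>P. a p * (f p - (s + \<kappa> * (\<beta> / 2))))"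
      by (simp only: fP sum_distrib_left cong: sum.cong)
    also have "\<dots> = (\<Sum>p\<in>P. a p * f p) - (\<Sum>p\<in>P. a p) * (s + \<kappa> * (\<beta> / 2))"
      by (simp add: right_diff_distrib sum_subtractf sum_distrib_right)
    also have "\<dots> = (\<Sum>p\<in>P. a p * apply_bcontfun (f - w) p)"
      using w sum0 by (simp add: right_diff_distrib sum_subtractf)
    also have "\<dots> \<le> (\<Sum>p\<in>P. \<bar>a p\<bar> * norm (f - w))"
    proof (rule sum_mono)
      fix p
      have "a p * apply_bcontfun (f - w) p \<le> \<bar>a p\<bar> * \<bar>apply_bcontfun (f - w) p\<bar>"
        by (metis abs_ge_self abs_mult)
      also have "\<dots> \<le> \<bar>a p\<bar> * norm (f - w)"
        using norm_bounded[of "f - w" p] by (intro mult_left_mono) auto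
      finally show "a p * apply_bcontfun (f - w) p \<le> \<bar>a p\<bar> * norm (f - w)" .
    qed
    finally have "\<kappa> * (\<beta> / 2) * (\<Sum>p\<in>P. \<bar>a p\<bar>) \<le> norm (f - w) * (\<Sum>p\<in>P. \<bar>a p\<bar>)"
      by (simp flip: sum_distrib_right add: mult.commute[of "norm (f - w)"])
    then show ?thesis using pos by simp
  qed
  with Lip ge show thesis by (rule that)
qed

subsection \<open>Separated points on the sphere\<close>

definition flat :: "'n::finite \<Rightarrow> real ^ 'n \<Rightarrow> real ^ 'n"
  where "flat k x = x - (x $ k) *\<^sub>R axis k 1"

lemma flat_nth: "flat k x $ i = (if i = k then 0 else x $ i)"
  by (simp add: flat_def axis_def)

lemma flat_diff: "flat k (x - y) = flat k x - flat k y"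
  by (simp add: flat_def algebra_simps)

lemma flat_eq: "x $ k = 0 \<Longrightarrow> flat k x = x"
  by (simp add: flat_def)

lemma norm_sq_flat: "(norm x)\<^sup>2 = (norm (flat k x))\<^sup>2 + (x $ k)\<^sup>2"
  unfolding power2_norm_eq_inner flat_def
  by (simp add: inner_diff inner_axis inner_axis' algebra_simps power2_eq_square)

lemma norm_flat_le: "norm (flat k x) \<le> norm x"
  by (rule power2_le_imp_le) (simp_all add: norm_sq_flat[of x k])

lemma continuous_on_flat: "continuous_on A (flat k)"
  unfolding flat_def by (intro continuous_intros)

text \<open>A cylinder of height 1 replaces the (n-1)-dimensional disc of radius \<open>r\<close>,
  so that Lebesgue measure on the whole space can serve as (n-1)-dimensional volume.\<close>

definition cylinder :: "'n::finite \<Rightarrow> real \<Rightarrow> (real ^ 'n) set"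
  where "cylinder k r = {x. norm (flat k x) < r \<and> 0 < x $ k \<and> x $ k < 1}"

lemma open_cylinder: "open (cylinder k r)"
  unfolding cylinder_def
  by (intro open_Collect_conj open_Collect_less continuous_on_norm continuous_on_flat
      continuous_intros)

lemma lmeasurable_cylinder: "cylinder k r \<in> lmeasurable"
proof (rule lmeasurable_open)
  have "norm x \<le> r + 1" if "x \<in> cylinder k r" for x
  proof -
    have "norm x \<le> norm (flat k x) + norm ((x $ k) *\<^sub>R axis k (1::real))"
      by (metis flat_def norm_triangle_sub add.commute)
    with that show ?thesis by (simp add: cylinder_def norm_axis_1)
  qed
  then show "bounded (cylinder k r)" by (auto simp: bounded_iff)
qed (rule open_cylinder)

lemma measure_cylinder_pos: "0 < measure lebesgue (cylinder k 1)"
proof -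
  have "(1 / 2) *\<^sub>R axis k 1 \<in> cylinder k 1"
    by (simp add: cylinder_def flat_def)
  then have "\<not> negligible (cylinder k 1)"
    using open_not_negligible open_cylinder by blast
  then have "measure lebesgue (cylinder k 1) \<noteq> 0"
    using lmeasurable_cylinder by (auto simp: negligible_iff_measure)
  then show ?thesis using measure_nonneg[of lebesgue "cylinder k 1"] by linarith
qed

text \<open>Stretching every coordinate except \<open>k\<close> by \<open>r\<close> maps the unit
  cylinder onto this one and has determinant \<open>r ^ (CARD('n) - 1)\<close>.\<close>

lemma measure_cylinder:
  fixes k :: "'n::finite"
  assumes "0 < r"
  shows "measure lebesgue (cylinder k r) = r ^ (CARD('n) - 1) * measure lebesgue (cylinder k 1)"
proof -
  define m where "m j = (if j = k then 1 else r)" for j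
  let ?S = "\<lambda>x. \<chi> j. m j * x $ j"
  have fl: "flat k (?S x) = r *\<^sub>R flat k x" and nth: "?S x $ k = x $ k" for x
    by (simp_all add: vec_eq_iff flat_nth m_def)
  have "cylinder k r = ?S ` cylinder k 1"
  proof (intro equalityI subsetI)
    fix x assume x: "x \<in> cylinder k r"
    define y where "y = (\<chi> j. x $ j / m j)"
    have xy: "x = ?S y" using assms by (simp add: y_def m_def vec_eq_iff)
    have "norm (flat k x) = r * norm (flat k y)" "x $ k = y $ k"
      using assms by (subst xy, simp add: fl, simp add: y_def m_def)
    then have "y \<in> cylinder k 1"
      using x assms by (simp add: cylinder_def)
    then show "x \<in> ?S ` cylinder k 1" using xy by blast
  qed (use assms in \<open>auto simp: cylinder_def fl, simp_all add: m_def\<close>)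
  moreover have "prod m UNIV = r ^ (CARD('n) - 1)"
  proof -
    have "prod m UNIV = prod m (UNIV - {k})"
      by (subst prod.remove[of UNIV k]) (auto simp: m_def)
    also have "\<dots> = (\<Prod>j\<in>UNIV - {k}. r)"
      by (rule prod.cong) (auto simp: m_def)
    finally show ?thesis by (simp add: card_Diff_singleton)
  qed
  ultimately show ?thesis
    using measure_stretch[OF lmeasurable_cylinder, of m k 1] assms by simp
qed

text \<open>Greedy packing: as long as the \<epsilon>-cylinders around the chosen points have total
  volume below that of the unit cylinder, they leave some point uncovered, and its projection can be
  added.\<close>

lemma exists_separated_in_disc:
  fixes k :: "'n::finite"
  assumes \<epsilon>: "0 < \<epsilon>"
    and D: "real D * \<epsilon> ^ (CARD('n) - 1) \<le> 1"
  shows "\<exists>Q :: (real ^ 'n) set. finite Q \<and> card Q = D \<and> (\<forall>q\<in>Q. q $ k = 0 \<and> norm q < 1) \<and>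
    (\<forall>p\<in>Q. \<forall>q\<in>Q. p \<noteq> q \<longrightarrow> \<epsilon> \<le> dist p q)"
  using D
proof (induction D)
  case 0
  show ?case by (intro exI[of _ "{}"]) simp
next
  case (Suc D)
  \<comment> \<open>The hypothesis concerns \<open>Suc D\<close> points; the extra positive term
    gives the strict inequality for the \<open>D\<close> points already chosen.\<close>
  have lt: "real D * \<epsilon> ^ (CARD('n) - 1) < 1"
    using Suc.prems zero_less_power[OF \<epsilon>, of "CARD('n) - 1"] by (simp add: algebra_simps)
  with Suc.IH obtain Q :: "(real ^ 'n) set" where Q: "finite Q" "card Q = D"
    "\<And>q. q \<in> Q \<Longrightarrow> q $ k = 0 \<and> norm q < 1"
    "\<And>p q. \<lbrakk>p \<in> Q; q \<in> Q; p \<noteq> q\<rbrakk> \<Longrightarrow> \<epsilon> \<le> dist p q"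
    by (metis less_imp_le)
  let ?V = "measure lebesgue (cylinder k 1)"
  let ?U = "\<Union>q\<in>Q. (+) q ` cylinder k \<epsilon>"
  have meas: "(+) q ` cylinder k \<epsilon> \<in> lmeasurable" for q
    by (intro measurable_translation lmeasurable_cylinder)
  have "\<not> cylinder k 1 \<subseteq> ?U"
  proof
    assume "cylinder k 1 \<subseteq> ?U"
    then have "?V \<le> measure lebesgue ?U"
      using Q(1) meas by (intro measure_mono_fmeasurable fmeasurable.finite_UN
          fmeasurableD lmeasurable_cylinder) (auto simp: fmeasurableD)
    also have "\<dots> \<le> (\<Sum>q\<in>Q. measure lebesgue ((+) q ` cylinder k \<epsilon>))"
      using Q(1) meas by (intro measure_UNION_le) auto
    also have "\<dots> = real D * \<epsilon> ^ (CARD('n) - 1) * ?V"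
      using Q(2) by (simp add: measure_translation measure_cylinder[OF \<epsilon>])
    also have "\<dots> < ?V"
      using lt measure_cylinder_pos[of k] by simp
    finally show False by simp
  qed
  then obtain x where x: "x \<in> cylinder k 1" "x \<notin> ?U" by blast
  define p where "p = flat k x"
  have p: "p $ k = 0" "norm p < 1"
    using x(1) by (simp_all add: p_def flat_nth cylinder_def)
  \<comment> \<open>Each \<open>q\<close> has height 0, so \<open>x - q\<close> keeps the height of
    \<open>x\<close>; only the horizontal distance can keep \<open>x\<close> out of the translated
    cylinder.\<close>
  have far: "\<epsilon> \<le> dist p q" if "q \<in> Q" for q
  proof (rule ccontr)
    assume "\<not> ?thesis"
    moreover have "flat k (x - q) = p - q"
      using Q(3)[OF that] by (simp add: flat_diff flat_eq p_def)
    ultimately have "x - q \<in> cylinder k \<epsilon>"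
      using x(1) Q(3)[OF that] by (simp add: cylinder_def dist_norm)
    then have "x \<in> (+) q ` cylinder k \<epsilon>" by (metis add_diff_cancel_left' add.commute diff_add_cancel imageI)
    with x(2) that show False by blast
  qed
  with \<epsilon> have "p \<notin> Q" by force
  then show ?case
    using Q p far by (intro exI[of _ "insert p Q"]) (auto simp: dist_commute)
qed

text \<open>
  Vertical projection of the open upper hemisphere onto the disc is a contraction, so a separated
  set in the disc lifts to one in the hemisphere; the south pole then provides one more point.
\<close>

lemma exists_separated_on_sphere:
  assumes \<epsilon>: "0 < \<epsilon>" "\<epsilon> \<le> 1"
    and D: "real D * \<epsilon> ^ (CARD('n::finite) - 1) \<le> 1"
  shows "\<exists>P :: 'n usphere set. finite P \<and> card P = Suc D \<and>
    (\<forall>p\<in>P. \<forall>q\<in>P. p \<noteq> q \<longrightarrow> \<epsilon> \<le> dist p q)"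
proof -
  fix k :: 'n
  obtain Q :: "(real ^ 'n) set" where Q: "finite Q" "card Q = D"
    "\<And>q. q \<in> Q \<Longrightarrow> q $ k = 0 \<and> norm q < 1"
    "\<And>p q. \<lbrakk>p \<in> Q; q \<in> Q; p \<noteq> q\<rbrakk> \<Longrightarrow> \<epsilon> \<le> dist p q"
    using exists_separated_in_disc[OF \<epsilon>(1) D, of k] by blast
  define up where "up q = q + sqrt (1 - (norm q)\<^sup>2) *\<^sub>R axis k 1" for q :: "real ^ 'n"
  have flat_up: "flat k (up q) = q" and up_nth: "up q $ k = sqrt (1 - (norm q)\<^sup>2)"
    if "q \<in> Q" for q
    using Q(3)[OF that] by (simp_all add: up_def flat_def)
  have point_up: "point (Usphere (up q)) = up q" if "q \<in> Q" for q
  proof -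
    have "(norm q)\<^sup>2 \<le> 1" using Q(3)[OF that] by (simp add: power_le_one)
    then have "(norm (up q))\<^sup>2 = 1"
      unfolding norm_sq_flat[of "up q" k] flat_up[OF that] up_nth[OF that] by simp
    then have "norm (up q) = 1"
      by (metis norm_ge_zero one_power2 power2_eq_iff_nonneg zero_le_one)
    then show ?thesis by (intro Usphere_inverse) simp
  qed
  define sp :: "'n usphere" where "sp = Usphere (- axis k 1)"
  have point_sp: "point sp = - axis k 1"
    unfolding sp_def by (intro Usphere_inverse) simp
  have far: "\<epsilon> \<le> dist (Usphere (up p)) (Usphere (up q))" if "p \<in> Q" "q \<in> Q" "p \<noteq> q" for p q
  proof -
    have "\<epsilon> \<le> norm (flat k (up p - up q))"
      using Q(4)[OF that] that by (simp add: flat_diff flat_up dist_norm)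
    also have "\<dots> \<le> dist (Usphere (up p)) (Usphere (up q))"
      using that by (simp add: dist_usphere_def point_up dist_norm norm_flat_le)
    finally show ?thesis .
  qed
  have far_sp: "\<epsilon> \<le> dist (Usphere (up q)) sp" if "q \<in> Q" for q
  proof -
    have "0 \<le> up q $ k"
      using Q(3)[OF that] by (simp add: up_nth[OF that] power_le_one)
    \<comment> \<open>The south pole has height -1 and the lifted points have height at least 0, so
      their distance is at least 1, hence at least \<epsilon>.\<close>
    then have "1 \<le> \<bar>(up q - (- axis k 1)) $ k\<bar>" by simp
    also have "\<dots> \<le> norm (up q - (- axis k 1))" by (rule component_le_norm_cart)
    finally show ?thesis
      using that \<epsilon>(2) by (simp add: dist_usphere_def point_up point_sp dist_norm)
  qed
  let ?U = "(\<lambda>q. Usphere (up q)) ` Q"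
  have "inj_on (\<lambda>q. Usphere (up q)) Q"
  proof (rule inj_onI)
    fix p q assume "p \<in> Q" "q \<in> Q" "Usphere (up p) = Usphere (up q)"
    then show "p = q" using far[of p q] \<epsilon>(1) by force
  qed
  then have "card ?U = D" using Q(2) by (simp add: card_image)
  moreover have "sp \<notin> ?U" using far_sp \<epsilon>(1) by force
  ultimately show ?thesis
    using Q(1) far far_sp
    by (intro exI[of _ "insert sp ?U"]) (auto simp: dist_commute)
qed

text \<open>With \<epsilon> the stated power of the dimension,
  \<open>dim W * \<epsilon> ^ (CARD('n) - 1)\<close> equals 1, just what the packing permits. It
  supplies \<open>dim W + 1\<close> points, one more than a basis has elements, so an annihilating
  measure exists.\<close>

lemma Lip_far_from_subspace:
  fixes W :: "'n::finite csphere set"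
  assumes n: "2 \<le> CARD('n)" and \<kappa>: "0 \<le> \<kappa>"
    and W: "finite B" "span B = W" "\<And>c. const_bcontfun c \<in> W"
  obtains f where "f \<in> Lip \<kappa>"
    "\<kappa> * (real (dim W) powr (- (1 / (real CARD('n) - 1))) / 2) \<le> infdist f W"
proof -
  define m where "m = real CARD('n) - 1"
  have m: "0 < m" "m = real (CARD('n) - 1)" using n by (simp_all add: m_def of_nat_diff)
  obtain A where A: "A \<subseteq> W" "independent A" "W \<subseteq> span A" "card A = dim W"
    by (rule basis_exists)
  then have "finite A" using independent_span_bound[of B A] W by auto
  \<comment> \<open>The constant 1 is a nonzero element of \<open>W\<close>, so the dimension is at
    least 1; this gives 0 < \<epsilon> \<le> 1.\<close>
  have "A \<noteq> {}"
  proof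
    assume "A = {}"
    with A(3) W(3)[of 1] have "const_bcontfun 1 = (0 :: 'n csphere)" by auto
    then have "apply_bcontfun (const_bcontfun 1 :: 'n csphere) x = apply_bcontfun 0 x" for x by simp
    then show False by (simp add: const_bcontfun.rep_eq)
  qed
  with \<open>finite A\<close> A(4) have D: "1 \<le> dim W" by (metis Suc_leI card_gt_0_iff One_nat_def)
  define \<epsilon> where "\<epsilon> = real (dim W) powr (- (1 / m))"
  have \<epsilon>: "0 < \<epsilon>" "\<epsilon> \<le> 1"
    using D m(1) powr_mono[of "- (1 / m)" 0 "real (dim W)"] by (simp_all add: \<epsilon>_def)
  have "\<epsilon> ^ (CARD('n) - 1) = real (dim W) powr (- (1 / m) * m)"
    using D by (simp add: \<epsilon>_def m(2) powr_powr flip: powr_realpow)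
  also have "\<dots> = inverse (real (dim W))"
    using D m(1) by (simp add: powr_minus)
  finally have "real (dim W) * \<epsilon> ^ (CARD('n) - 1) \<le> 1"
    using D by simp
  from exists_separated_on_sphere[OF \<epsilon> this]
  obtain P :: "'n usphere set" where P: "finite P" "card P = Suc (dim W)"
    "\<And>p q. \<lbrakk>p \<in> P; q \<in> P; p \<noteq> q\<rbrakk> \<Longrightarrow> \<epsilon> \<le> dist p q"
    by auto
  obtain a where a: "\<exists>p\<in>P. a p \<noteq> 0" "\<And>b. b \<in> A \<Longrightarrow> (\<Sum>p\<in>P. a p * apply_bcontfun b p) = 0"
    using exists_annihilator[OF \<open>finite A\<close> P(1), of apply_bcontfun] A(4) P(2) by auto
  have aW: "(\<Sum>p\<in>P. a p * apply_bcontfun w p) = 0" if "w \<in> W" for w :: "'n csphere"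
  proof -
    have "w \<in> span A" using that A(3) by blast
    then show ?thesis
    proof (induction rule: span_induct_alt)
      case (step c x y)
      have "(\<Sum>p\<in>P. a p * apply_bcontfun (c *\<^sub>R x + y) p) =
        c * (\<Sum>p\<in>P. a p * apply_bcontfun x p) + (\<Sum>p\<in>P. a p * apply_bcontfun y p)"
        by (simp add: distrib_left sum.distrib sum_distrib_left mult.left_commute)
      then show ?case
        using a(2)[OF step(1)] step(2) by simp
    qed simp
  qed
  have sum0: "(\<Sum>p\<in>P. a p) = 0"
    using aW[OF W(3)[of 1]] by (simp add: const_bcontfun.rep_eq)
  obtain f :: "'n csphere" where f: "f \<in> Lip \<kappa>"
    "\<And>w :: 'n csphere. (\<Sum>p\<in>P. a p * apply_bcontfun w p) = 0 \<Longrightarrow> \<kappa> * (\<epsilon> / 2) \<le> norm (f - w)"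
    by (rule Lip_far_from_annihilated[of P \<epsilon> \<kappa> 0 a]) (use P(1,3) \<epsilon>(1) \<kappa> a(1) sum0 in auto)
  have "W \<noteq> {}" using W(3) by blast
  have "\<kappa> * (\<epsilon> / 2) \<le> infdist f W"
    unfolding infdist_notempty[OF \<open>W \<noteq> {}\<close>] dist_norm
    by (rule cINF_greatest[OF \<open>W \<noteq> {}\<close>]) (rule f(2)[OF aW])
  with f(1) show thesis using that by (simp add: \<epsilon>_def m_def)
qed

subsection \<open>Polynomials on a great circle\<close>

text \<open>On the unit circle of a coordinate plane, polynomials of degree at most \<open>d\<close>
  are spanned by the monomials in two coordinates whose second exponent is 0 or 1. At most 2(d+1) of
  these occur, so the bound decays like 1/d in every dimension.\<close>

lemma Lip_far_from_polys:
  assumes n: "2 \<le> CARD('n::finite)" and \<kappa>: "0 \<le> \<kappa>" and s: "0 \<le> s"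
  obtains f :: "'n::finite csphere" where "f \<in> Lip \<kappa>" "\<And>x. s \<le> f x"
    "\<And>p. p \<in> sphere_polys d \<Longrightarrow> \<kappa> * (1 / (4 * (real d + 1))) \<le> norm (f - p)"
proof -
  obtain i j :: 'n where ij: "i \<noteq> j"
    using n card_le_Suc0_iff_eq[of "UNIV :: 'n set"] by auto
  \<comment> \<open>This is the number of pairs in \<open>?B\<close> below; the indices from 0 to
    \<open>N\<close> then give one point more than there are equations.\<close>
  define N where "N = 2 * d + 2"
  \<comment> \<open>Points on a quarter circle with equally spaced \<open>i\<close>-coordinates,
    hence at mutual distance at least \<open>1 / N\<close>.\<close>
  define v :: "nat \<Rightarrow> real ^ 'n" where
    "v k = (real k / N) *\<^sub>R axis i 1 + sqrt (1 - (real k / N)\<^sup>2) *\<^sub>R axis j 1" for k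
  have vi: "v k $ i = real k / N" and vj: "v k $ j = sqrt (1 - (real k / N)\<^sup>2)"
    and v0: "l \<noteq> i \<Longrightarrow> l \<noteq> j \<Longrightarrow> v k $ l = 0" for k l
    using ij by (auto simp: v_def axis_def)
  have le1: "(real k / N)\<^sup>2 \<le> 1" if "k \<le> N" for k
    using that by (simp add: power_le_one N_def)
  have point_v: "point (Usphere (v k)) = v k" if "k \<le> N" for k
  proof -
    have "(norm (v k))\<^sup>2 = (\<Sum>l\<in>UNIV. (v k $ l)\<^sup>2)"
      by (simp add: norm_vec_def L2_set_def sum_nonneg)
    also have "\<dots> = (\<Sum>l\<in>{i, j}. (v k $ l)\<^sup>2)"
      by (rule sum.mono_neutral_right) (auto simp: v0)
    also have "\<dots> = 1"
      using ij le1[OF that] by (simp add: vi vj)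
    finally have "norm (v k) = 1"
      by (metis norm_ge_zero one_power2 power2_eq_iff_nonneg zero_le_one)
    then show ?thesis by (intro Usphere_inverse) simp
  qed
  define P where "P = (\<lambda>k. Usphere (v k)) ` {..N}"
  have P: "point p $ l = 0" if "p \<in> P" "l \<noteq> i" "l \<noteq> j" for p l
    using that v0 by (auto simp: P_def point_v)
  have Psq: "(point p $ j)\<^sup>2 = 1 - (point p $ i)\<^sup>2" if "p \<in> P" for p
    using that le1 by (auto simp: P_def point_v vi vj)
  have far: "1 / N \<le> dist (Usphere (v k)) (Usphere (v l))" if "k \<le> N" "l \<le> N" "k \<noteq> l" for k l
  proof -
    have "1 / N \<le> \<bar>real k - real l\<bar> / N"
      using that(3) by (intro divide_right_mono) auto
    also have "\<dots> = \<bar>(v k - v l) $ i\<bar>"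
      by (simp add: vi abs_divide flip: diff_divide_distrib)
    also have "\<dots> \<le> norm (v k - v l)" by (rule component_le_norm_cart)
    finally show ?thesis using that by (simp add: dist_usphere_def point_v dist_norm)
  qed
  have "inj_on (\<lambda>k. Usphere (v k)) {..N}"
  proof (rule inj_onI)
    fix k l assume "k \<in> {..N}" "l \<in> {..N}" "Usphere (v k) = Usphere (v l)"
    then show "k = l" using far[of k l] by (force simp: N_def)
  qed
  then have card: "card P = N + 1" "finite P" by (simp_all add: P_def card_image)
  let ?B = "{..d} \<times> {..1::nat}"
  obtain a where a: "\<exists>p\<in>P. a p \<noteq> 0"
    "\<And>e b. \<lbrakk>e \<le> d; b \<le> 1\<rbrakk> \<Longrightarrow> (\<Sum>p\<in>P. a p * (point p $ i ^ e * point p $ j ^ b)) = 0"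
  proof -
    have "card ?B < card P" using card(1) by (simp add: N_def)
    from exists_annihilator[OF _ card(2) this, of "\<lambda>(e, b) p. point p $ i ^ e * point p $ j ^ b"]
    obtain a where "\<exists>p\<in>P. a p \<noteq> 0"
      and "\<forall>eb\<in>?B. (\<Sum>p\<in>P. a p * (case eb of (e, b) \<Rightarrow> \<lambda>p. point p $ i ^ e * point p $ j ^ b) p) = 0"
      by auto
    then show thesis by (intro that[of a]) (auto dest: bspec)
  qed
  \<comment> \<open>Replacing the square of the \<open>j\<close>-coordinate by 1 minus the square of
    the \<open>i\<close>-coordinate lowers \<open>b\<close> by 2 without raising the total degree,
    until \<open>b\<close> is 0 or 1.\<close>
  have ann: "(\<Sum>p\<in>P. a p * (point p $ i ^ e * point p $ j ^ b)) = 0" if "e + b \<le> d" for e b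
    using that
  proof (induction b arbitrary: e rule: less_induct)
    case (less b)
    show ?case
    proof (cases "b \<le> 1")
      case True
      then show ?thesis using a(2)[of e b] less.prems by simp
    next
      case False
      then obtain c where c: "b = c + 2" by (metis add.commute le_add_diff_inverse not_less_eq_eq numeral_2_eq_2 One_nat_def)
      have "(\<Sum>p\<in>P. a p * (point p $ i ^ e * point p $ j ^ b)) =
        (\<Sum>p\<in>P. a p * (point p $ i ^ e * point p $ j ^ c)
             - a p * (point p $ i ^ (e + 2) * point p $ j ^ c))"
      proof (rule sum.cong)
        fix p assume "p \<in> P"
        have *: "point p $ j ^ b = (1 - (point p $ i)\<^sup>2) * point p $ j ^ c"
          unfolding c power_add Psq[OF \<open>p \<in> P\<close>] by simp
        show "a p * (point p $ i ^ e * point p $ j ^ b) =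
          a p * (point p $ i ^ e * point p $ j ^ c) - a p * (point p $ i ^ (e + 2) * point p $ j ^ c)"
          unfolding * power_add by (simp add: algebra_simps)
      qed simp
      also have "\<dots> = 0"
        using less.IH[of c e] less.IH[of c "e + 2"] less.prems c by (simp add: sum_subtractf)
      finally show ?thesis .
    qed
  qed
  \<comment> \<open>A monomial involving any third coordinate vanishes on \<open>P\<close>; the
    others are covered by \<open>ann\<close>.\<close>
  have mono: "(\<Sum>p\<in>P. a p * (\<Prod>l\<in>UNIV. (point p $ l) ^ \<alpha> l)) = 0"
    if \<alpha>: "(\<Sum>l\<in>UNIV. \<alpha> l) \<le> d" for \<alpha> :: "'n \<Rightarrow> nat"
  proof (cases "\<exists>l. l \<noteq> i \<and> l \<noteq> j \<and> \<alpha> l \<noteq> 0")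
    case True
    then obtain l where "l \<noteq> i" "l \<noteq> j" "\<alpha> l \<noteq> 0" by blast
    then have "(\<Prod>l\<in>UNIV. (point p $ l) ^ \<alpha> l) = 0" if "p \<in> P" for p
      using P[OF that, of l] by (intro prod_zero) (auto intro!: bexI[of _ l])
    then show ?thesis by (intro sum.neutral) (simp del: prod_zero_iff)
  next
    case False
    then have z: "\<alpha> l = 0" if "l \<notin> {i, j}" for l using that by blast
    have "(\<Sum>l\<in>{i, j}. \<alpha> l) \<le> (\<Sum>l\<in>UNIV. \<alpha> l)" by (rule sum_mono2) auto
    with \<alpha> ij have "\<alpha> i + \<alpha> j \<le> d" by simp
    moreover have "(\<Prod>l\<in>UNIV. (x $ l) ^ \<alpha> l) = x $ i ^ \<alpha> i * x $ j ^ \<alpha> j" for x :: "real ^ 'n"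
    proof -
      have "(\<Prod>l\<in>UNIV. (x $ l) ^ \<alpha> l) = (\<Prod>l\<in>{i, j}. (x $ l) ^ \<alpha> l)"
        by (rule prod.mono_neutral_right) (auto simp: z)
      then show ?thesis using ij by simp
    qed
    ultimately show ?thesis using ann by simp
  qed
  have sum0: "(\<Sum>p\<in>P. a p) = 0" using ann[of 0 0] by simp
  obtain f :: "'n csphere" where f: "f \<in> Lip \<kappa>" "\<And>x. s \<le> f x"
    "\<And>w :: 'n csphere. (\<Sum>p\<in>P. a p * apply_bcontfun w p) = 0 \<Longrightarrow> \<kappa> * (1 / real N / 2) \<le> norm (f - w)"
  proof (rule Lip_far_from_annihilated[of P "1 / real N" \<kappa> s a])
    fix p q assume "p \<in> P" "q \<in> P" "p \<noteq> q"
    then show "1 / N \<le> dist p q" using far by (auto simp: P_def)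
  qed (use card(2) \<kappa> s a(1) sum0 in auto)
  have "\<kappa> * (1 / (4 * (real d + 1))) \<le> norm (f - q)" if "q \<in> sphere_polys d" for q
  proof -
    obtain Q where "poly_deg_le d Q" and Q: "\<And>x. q x = Q (point x)"
      using \<open>q \<in> sphere_polys d\<close> by (auto simp: sphere_polys_def)
    then obtain c where "\<And>x. Q x = (\<Sum>\<alpha> | (\<Sum>l\<in>UNIV. \<alpha> l) \<le> d. c \<alpha> * (\<Prod>l\<in>UNIV. (x $ l) ^ \<alpha> l))"
      unfolding poly_deg_le_def by blast
    with Q have c: "q x = (\<Sum>\<alpha> | (\<Sum>l\<in>UNIV. \<alpha> l) \<le> d. c \<alpha> * (\<Prod>l\<in>UNIV. (point x $ l) ^ \<alpha> l))" for x
      by simp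
    have "(\<Sum>p\<in>P. a p * apply_bcontfun q p) =
      (\<Sum>\<alpha> | (\<Sum>l\<in>UNIV. \<alpha> l) \<le> d. c \<alpha> * (\<Sum>p\<in>P. a p * (\<Prod>l\<in>UNIV. (point p $ l) ^ \<alpha> l)))"
      unfolding c sum_distrib_left by (subst sum.swap) (simp add: mult.left_commute)
    also have "\<dots> = 0" by (simp add: mono)
    finally show ?thesis using f(3)[of q] by (simp add: N_def algebra_simps)
  qed
  with f(1,2) show thesis by (rule that)
qed

subsection \<open>Starbodies with prescribed radial function\<close>

text \<open>The body is the continuous image of the compact product of [0,1] and the sphere, which
  gives compactness at once. A ball whose radius is the minimum of \<rho> lies inside.\<close>

lemma exists_starbody:
  fixes \<rho> :: "'n::finite usphere \<Rightarrow> real"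
  assumes cont: "continuous_on UNIV \<rho>" and pos: "\<And>x. 0 < \<rho> x"
  obtains L where "starbody L" "\<And>t x. 0 < t \<Longrightarrow> t *\<^sub>R point x \<in> L \<longleftrightarrow> t \<le> \<rho> x"
proof -
  define L where "L = (\<lambda>(t, x). (t * \<rho> x) *\<^sub>R point x) ` ({0..1} \<times> UNIV)"
  have L: "y \<in> L \<longleftrightarrow> (\<exists>t x. 0 \<le> t \<and> t \<le> 1 \<and> y = (t * \<rho> x) *\<^sub>R point x)" for y
    by (auto simp: L_def image_iff)
  have mem: "t *\<^sub>R point x \<in> L \<longleftrightarrow> t \<le> \<rho> x" if "0 < t" for t x
  proof
    assume "t *\<^sub>R point x \<in> L"
    then obtain s z where s: "0 \<le> s" "s \<le> 1" "t *\<^sub>R point x = (s * \<rho> z) *\<^sub>R point z"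
      by (auto simp: L)
    then have "norm (t *\<^sub>R point x) = norm ((s * \<rho> z) *\<^sub>R point z)" by simp
    then have t: "t = s * \<rho> z" using that s(1) pos[of z] by simp
    with s(3) that have "x = z" by (auto simp: point_inject)
    with t s(2) pos[of z] show "t \<le> \<rho> x" by (simp add: mult_left_le_one_le s(1))
  next
    assume "t \<le> \<rho> x"
    with that pos[of x] show "t *\<^sub>R point x \<in> L"
      unfolding L by (intro exI[of _ "t / \<rho> x"] exI[of _ x]) (simp add: field_simps)
  qed
  have "compact L"
    unfolding L_def
  proof (rule compact_continuous_image)
    show "continuous_on ({0..1} \<times> UNIV) (\<lambda>(t, x). (t * \<rho> x) *\<^sub>R point x)"
      unfolding case_prod_beta
      by (intro continuous_intros continuous_on_compose2[OF cont]
          continuous_on_compose2[OF continuous_on_point]) auto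
    show "compact ({0..1::real} \<times> (UNIV :: 'n usphere set))"
      by (intro compact_Times compact_UNIV_usphere compact_Icc)
  qed
  moreover have "closed_segment 0 y \<subseteq> L" if "y \<in> L" for y
  proof
    fix z assume "z \<in> closed_segment 0 y"
    then obtain u where u: "0 \<le> u" "u \<le> 1" "z = u *\<^sub>R y" by (auto simp: in_segment)
    obtain t x where t: "0 \<le> t" "t \<le> 1" "y = (t * \<rho> x) *\<^sub>R point x"
      using \<open>y \<in> L\<close> by (auto simp: L)
    show "z \<in> L"
      unfolding L using u t
      by (intro exI[of _ "u * t"] exI[of _ x]) (simp add: mult_le_one mult.assoc)
  qed
  moreover have "0 \<in> interior L"
  proof -
    obtain x0 where x0: "\<And>x. \<rho> x0 \<le> \<rho> x"
      using continuous_attains_inf[OF compact_UNIV_usphere _ cont] by auto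
    have "y \<in> L" if "y \<in> ball 0 (\<rho> x0)" for y
    proof (cases "y = 0")
      case True
      then show ?thesis unfolding L by (auto intro!: exI[of _ 0])
    next
      case False
      define x where "x = Usphere (y /\<^sub>R norm y)"
      have "point x = y /\<^sub>R norm y"
        unfolding x_def using False by (intro Usphere_inverse) simp
      then have "y = norm y *\<^sub>R point x" using False by simp
      moreover have "norm y *\<^sub>R point x \<in> L"
        using that False x0[of x] by (subst mem) auto
      ultimately show ?thesis by simp
    qed
    then show ?thesis
      using pos[of x0] by (intro interiorI[of "ball 0 (\<rho> x0)"]) auto
  qed
  ultimately show thesis using mem by (intro that[of L]) (auto simp: starbody_def)
qed

text \<open>The gauge function is the reciprocal of the radial one, so a prescribed gauge
  \<open>f\<close> comes from the body with radial function \<open>1 / f\<close>.\<close>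

lemma exists_starbody_gauge_or_radial:
  fixes f :: "'n::finite csphere"
  assumes F: "F \<in> {gauge_fun, radial_fun}" and pos: "\<And>x. 0 < f x"
  shows "\<exists>L. starbody L \<and> apply_bcontfun f = F L"
proof -
  have cont: "continuous_on UNIV f" by (rule continuous_on_apply_bcontfun)
  from F consider "F = gauge_fun" | "F = radial_fun" by blast
  then show ?thesis
  proof cases
    case 1
    have "continuous_on UNIV (\<lambda>x. 1 / f x)"
      using pos by (intro continuous_intros cont) (auto simp: less_imp_neq[symmetric] dest: sym)
    then obtain L where L: "starbody L" "\<And>t x. 0 < t \<Longrightarrow> t *\<^sub>R point x \<in> L \<longleftrightarrow> t \<le> 1 / f x"
      using exists_starbody[of "\<lambda>x. 1 / f x"] pos by auto
    have "gauge_fun L x = f x" for x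
    proof -
      have "point x \<in> (\<lambda>y. t *\<^sub>R y) ` L \<longleftrightarrow> f x \<le> t" if "0 < t" for t
      proof -
        have "point x \<in> (\<lambda>y. t *\<^sub>R y) ` L \<longleftrightarrow> (1 / t) *\<^sub>R point x \<in> L"
          using that by (force simp: image_iff)
        then show ?thesis using L(2)[of "1 / t" x] that pos[of x] by (simp add: field_simps)
      qed
      then have "{t. 0 < t \<and> point x \<in> (\<lambda>y. t *\<^sub>R y) ` L} = {f x..}"
        using pos[of x] by (auto intro: less_le_trans)
      then show ?thesis by (simp add: gauge_fun_def)
    qed
    with L(1) 1 show ?thesis by (auto simp: fun_eq_iff)
  next
    case 2
    obtain L where L: "starbody L" "\<And>t x. 0 < t \<Longrightarrow> t *\<^sub>R point x \<in> L \<longleftrightarrow> t \<le> f x"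
      using exists_starbody[OF cont pos] by blast
    have "radial_fun L x = f x" for x
    proof -
      have "{t. 0 < t \<and> t *\<^sub>R point x \<in> L} = {0<..f x}" using L(2) by auto
      then show ?thesis using pos[of x] by (simp add: radial_fun_def)
    qed
    with L(1) 2 show ?thesis by (auto simp: fun_eq_iff)
  qed
qed

theorem theorem1p2:
  assumes n: "2 \<le> CARD('n::finite)"
  shows "(\<forall>\<kappa>>0. \<forall>W :: 'n csphere set.
            subspace W \<and> (\<exists>B. finite B \<and> span B = W) \<and> (\<forall>c. const_bcontfun c \<in> W) \<longrightarrow>
            (let \<beta> = min (real (dim W) powr (- (1 / (real CARD('n) - 1)))) (2 / \<kappa>)
             in (SUP f\<in>Lip \<kappa>. infdist f W) \<ge> \<kappa> * (\<beta> / 2)))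
       \<and> (\<forall>F \<in> {gauge_fun, radial_fun :: (real ^ 'n) set \<Rightarrow> 'n usphere \<Rightarrow> real}.
            \<exists>C\<^sub>0>0. \<forall>\<kappa>>0. \<forall>\<^sub>F d in sequentially.
              \<exists>L. starbody L \<and>
                (\<exists>f\<in>Lip \<kappa>. apply_bcontfun f = F L \<and>
                  (\<forall>p\<in>sphere_polys d. norm (f - p) \<ge> C\<^sub>0 * (\<kappa> / real d))))"
proof (intro conjI allI impI ballI)
  fix \<kappa> :: real and W :: "'n csphere set"
  assume \<kappa>: "\<kappa> > 0"
    and "subspace W \<and> (\<exists>B. finite B \<and> span B = W) \<and> (\<forall>c. const_bcontfun c \<in> W)"
  then obtain B where W: "finite B" "span B = W" "\<And>c. const_bcontfun c \<in> W"
    by blast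
  let ?\<epsilon> = "real (dim W) powr (- (1 / (real CARD('n) - 1)))"
  obtain f where f: "f \<in> Lip \<kappa>" "\<kappa> * (?\<epsilon> / 2) \<le> infdist f W"
    using Lip_far_from_subspace[OF n less_imp_le[OF \<kappa>] W] by blast
  \<comment> \<open>Taking the minimum with \<open>2 / \<kappa>\<close> can only lower the left-hand
    side.\<close>
  have "\<kappa> * (min ?\<epsilon> (2 / \<kappa>) / 2) \<le> \<kappa> * (?\<epsilon> / 2)"
    using \<kappa> by (intro mult_left_mono divide_right_mono) auto
  also note f(2)
  also have "infdist f W \<le> (SUP f\<in>Lip \<kappa>. infdist f W)"
    using bdd_above_infdist_Lip[of \<kappa> W] \<kappa> W(3) f(1) by (intro cSUP_upper) auto
  finally show "let \<beta> = min ?\<epsilon> (2 / \<kappa>) in (SUP f\<in>Lip \<kappa>. infdist f W) \<ge> \<kappa> * (\<beta> / 2)"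
    by (simp add: Let_def)
next
  fix F :: "(real ^ 'n) set \<Rightarrow> 'n usphere \<Rightarrow> real"
  assume F: "F \<in> {gauge_fun, radial_fun}"
  show "\<exists>C\<^sub>0>0. \<forall>\<kappa>>0. \<forall>\<^sub>F d in sequentially. \<exists>L. starbody L \<and>
      (\<exists>f\<in>Lip \<kappa>. apply_bcontfun f = F L \<and>
        (\<forall>p\<in>sphere_polys d. norm (f - p) \<ge> C\<^sub>0 * (\<kappa> / real d)))"
  \<comment> \<open>The constant comes from 4(d+1) \<le> 8d, valid from \<open>d = 1\<close>
    on.\<close>
  proof (intro exI[of _ "1 / 8"] conjI allI impI eventually_sequentiallyI)
    fix \<kappa> :: real and d :: nat
    assume \<kappa>: "\<kappa> > 0" and d: "1 \<le> d"
    \<comment> \<open>The floor 1 makes \<open>f\<close> strictly positive, as required of the gauge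
      or radial function of a starbody.\<close>
    obtain f :: "'n csphere" where f: "f \<in> Lip \<kappa>" "\<And>x. 1 \<le> f x"
      "\<And>p. p \<in> sphere_polys d \<Longrightarrow> \<kappa> * (1 / (4 * (real d + 1))) \<le> norm (f - p)"
      using Lip_far_from_polys[OF n less_imp_le[OF \<kappa>], of 1 d] by auto
    have "1 / 8 * (\<kappa> / real d) \<le> \<kappa> * (1 / (4 * (real d + 1)))"
      using \<kappa> d by (simp add: field_simps)
    moreover obtain L where "starbody L" "apply_bcontfun f = F L"
      using exists_starbody_gauge_or_radial[OF F, of f] f(2) by (meson less_le_trans zero_less_one)
    ultimately show "\<exists>L. starbody L \<and> (\<exists>f\<in>Lip \<kappa>. apply_bcontfun f = F L \<and>
        (\<forall>p\<in>sphere_polys d. norm (f - p) \<ge> 1 / 8 * (\<kappa> / real d)))"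
      using f(1,3) by (meson order_trans)
  qed simp
qed

end
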